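(* Let $X$ be a subgaussian random variable with symmetric distribution (about zero), and let $f(z)=\mathbb{E}\,e^{izX}$, $z\in\mathbb{C}$. If all zeros $z$ of $f$ with $\mathrm{Re}(z)\ge 0$ satisfy $|\mathrm{Arg}(z)|\le\frac{\pi}{8}$, then $X$ is strictly subgaussian.
   Context: A random variable $X$ is called subgaussian if $\mathbb{E}\,e^{cX^2}<\infty$ for some constant $c>0$; then its characteristic function extends from the real line to an entire function $f(z)=\mathbb{E}\,e^{izX}$ on $\mathbb{C}$. $X$ is called strictly subgaussian if $\mathbb{E}\,e^{tX}\le e^{\sigma^2t^2/2}$ for all $t\in\mathbb{R}$ with $\sigma^2=\mathrm{Var}(X)$. $\mathrm{Arg}$ is the principal argument, with values in $(-\pi,\pi]$. *)

theory Defs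
  imports "HOL-Probability.Probability"
begin

definition subgaussian :: "'a measure \<Rightarrow> ('a \<Rightarrow> real) \<Rightarrow> bool" where
  "subgaussian M X \<longleftrightarrow> (\<exists>c>0. integrable M (\<lambda>\<omega>. exp (c * (X \<omega>)\<^sup>2)))"

(* The Bochner integral of a non-integrable function is 0, so integrability of exp (t X) is
   required explicitly: the inequality is meant for a finite expectation. Integrability for all t
   also makes all moments, hence the variance, finite. *)
definition strictly_subgaussian :: "'a measure \<Rightarrow> ('a \<Rightarrow> real) \<Rightarrow> bool" where
  "strictly_subgaussian M X \<longleftrightarrow>
     (\<forall>t::real. integrable M (\<lambda>\<omega>. exp (t * X \<omega>)) \<and>
        prob_space.expectation M (\<lambda>\<omega>. exp (t * X \<omega>))
          \<le> exp (prob_space.variance M X * t\<^sup>2 / 2))"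

definition symmetric_distribution :: "'a measure \<Rightarrow> ('a \<Rightarrow> real) \<Rightarrow> bool" where
  "symmetric_distribution M X \<longleftrightarrow> distr M borel (\<lambda>\<omega>. - X \<omega>) = distr M borel X"

definition complex_char :: "'a measure \<Rightarrow> ('a \<Rightarrow> real) \<Rightarrow> complex \<Rightarrow> complex" where
  "complex_char M X z = (LINT \<omega>|M. exp (\<i> * z * of_real (X \<omega>)))"

lemma complex_char_of_real:
  assumes "X \<in> borel_measurable M"
  shows "complex_char M X (of_real t) = char (distr M borel X) t"
  using assms by (simp add: complex_char_def char_def integral_distr mult.assoc)

end

theory Submission
  imports Defs "HOL-Complex_Analysis.Complex_Analysis" "HOL-Real_Asymp.Real_Asymp"
begin

text \<open>
The statement compares the even entire function \<open>f\<close> on the imaginary axis, where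
\<open>f (it) = f (- it)\<close> is the moment generating function \<open>E exp (tX)\<close>, with its second-order behaviour at the
origin: since \<open>f 0 = 1\<close>, the second derivative of \<open>log f\<close> at \<open>0\<close> is \<open>- Var X\<close>.

A subgaussian variable gives \<open>|f z| \<le> exp (A |z|\<^sup>2 + B)\<close>, so Hadamard's theorem suggests writing \<open>f\<close> as the
exponential of a quadratic polynomial times a product of factors \<open>1 - z/a\<close> over the zeros \<open>a\<close>. On
the imaginary axis the exponential factor is matched exactly by its own second logarithmic
derivative at \<open>0\<close>. A zero \<open>a\<close> contributes \<open>1 + t\<^sup>2/a\<^sup>2\<close> to \<open>f (it) f (- it)\<close>, and \<open>- 1/a\<^sup>2\<close> to the second
logarithmic derivative; so it suffices that \<open>|1 + w| \<le> exp (Re w)\<close> for \<open>w = t\<^sup>2/a\<^sup>2\<close>. This holds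
as soon as \<open>|Arg w| \<le> pi/4\<close> (lemma \<open>norm_one_plus_le_exp_Re\<close>), which is the hypothesis
\<open>|Arg a| \<le> pi/8\<close>; zeros in the left half plane are covered because \<open>f\<close> is even and only \<open>a\<^sup>2\<close> matters.

The proof works with a truncation of this product. For fixed \<open>R\<close> only the finitely many zeros in the disc of radius
\<open>R\<close> are split off (\<open>factor_zeros_on_cball\<close>). The zero-free cofactor has a logarithm in that disc, and
Borel-Caratheodory together with Cauchy's and Taylor's estimates shows that this logarithm is
quadratic near \<open>0\<close> up to an error \<open>O (1 / R)\<close>
(\<open>norm_zero_free_imaginary_le\<close>, \<open>norm_factored_imaginary_le\<close>). Letting \<open>R\<close> tend to infinity gives
\<open>|f (it) f (- it)| \<le> exp (t\<^sup>2 Var X)\<close>, the square of the asserted inequality.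
\<close>

section \<open>Two inequalities\<close>

text \<open>The map \<open>w \<mapsto> w / (2M - w)\<close> sends the half plane \<open>Re w < M\<close> into the unit disc and fixes \<open>0\<close>, so
the claim is the Schwarz lemma for its composition with the rescaled function \<open>g\<close>.\<close>

lemma Borel_Caratheodory:
  assumes hol: "g holomorphic_on ball 0 R" and g0: "g 0 = 0"
    and bound: "\<And>z. norm z < R \<Longrightarrow> Re (g z) < M"
    and z: "norm z < R"
  shows "norm (g z) \<le> 2 * M * norm z / (R - norm z)"
proof -
  have R: "R > 0" using z norm_ge_zero[of z] by linarith
  have M: "M > 0" using bound[of 0] R g0 by simp
  define \<phi> where "\<phi> = (\<lambda>u :: complex. g (R * u) / (2 * M - g (R * u)))"
  have inside: "norm (R * u) < R" if "norm u < 1" for u :: complex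
    using that R by (simp add: norm_mult)
  have nz: "2 * M - g (R * u) \<noteq> 0" if "norm u < 1" for u :: complex
  proof
    assume "2 * M - g (R * u) = 0"
    hence "Re (g (R * u)) = 2 * M" by (simp add: complex_eq_iff)
    thus False using bound[OF inside[OF that]] M by simp
  qed
  have hol': "(\<lambda>u :: complex. g (R * u)) holomorphic_on ball 0 1"
    by (rule holomorphic_on_compose_gen[OF _ hol, unfolded o_def])
       (use inside in \<open>auto intro!: holomorphic_intros\<close>)
  have "norm (\<phi> u) < 1" if u: "norm u < 1" for u
  proof -
    let ?w = "g (R * u)"
    have "Re ?w < M" using bound[OF inside[OF u]] .
    hence "M * Re ?w < M * M" using M by simp
    hence "(norm ?w)\<^sup>2 < (norm (2 * M - ?w))\<^sup>2"
      by (simp add: cmod_power2) (simp add: power2_eq_square algebra_simps)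
    hence "norm ?w < norm (2 * M - ?w)"
      by (rule power2_less_imp_less) simp
    thus ?thesis using nz[OF u] by (simp add: \<phi>_def norm_divide)
  qed
  hence schwarz: "norm (\<phi> u) \<le> norm u" if "norm u < 1" for u
    using that hol' nz g0
    by (intro Schwarz_Lemma(1)) (auto simp: \<phi>_def intro!: holomorphic_intros)
  have u1: "norm (z / R) < 1" using z R by (simp add: norm_divide)
  have "norm (g z) / norm (2 * M - g z) \<le> norm z / R"
    using schwarz[OF u1] R by (simp add: \<phi>_def norm_divide)
  moreover have "norm (2 * M - g z) > 0" using nz[OF u1] R by simp
  ultimately have "norm (g z) * R \<le> norm z * norm (2 * M - g z)"
    using R by (simp add: field_simps)
  also have "\<dots> \<le> norm z * (2 * M + norm (g z))"
    using M norm_triangle_ineq4[of "complex_of_real (2 * M)" "g z"]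
    by (intro mult_left_mono) auto
  finally show ?thesis using z by (simp add: field_simps)
qed

text \<open>This is the place where the aperture of the zero sector enters. The general bound
\<open>1 + w \<le> exp w\<close> controls only the linear term; here \<open>|1 + w|\<^sup>2 = 1 + 2 Re w + |w|\<^sup>2\<close>, and the quadratic
term is absorbed by the term \<open>(2 Re w)\<^sup>2 / 2\<close> of the series of \<open>exp (2 Re w)\<close> exactly if
\<open>|w|\<^sup>2 \<le> 2 (Re w)\<^sup>2\<close>; for \<open>Re w \<ge> 0\<close> this says that the argument of \<open>w\<close> is at most \<open>pi / 4\<close> in modulus. The lemma is
applied to \<open>w = t\<^sup>2 / a\<^sup>2\<close>, whose argument is twice that of the zero \<open>a\<close> up to sign.\<close>

lemma norm_one_plus_le_exp_Re:
  assumes "\<bar>Im w\<bar> \<le> Re w"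
  shows "norm (1 + w) \<le> exp (Re w)"
proof (rule power2_le_imp_le)
  have "(Im w)\<^sup>2 \<le> (Re w)\<^sup>2"
    using assms by (simp add: abs_le_square_iff[symmetric])
  hence "(norm (1 + w))\<^sup>2 \<le> 1 + 2 * Re w + (2 * Re w)\<^sup>2 / 2"
    by (simp add: cmod_power2) (simp add: power2_eq_square algebra_simps)
  also have "\<dots> \<le> exp (2 * Re w)"
    using assms by (intro exp_lower_Taylor_quadratic) auto
  also have "\<dots> = (exp (Re w))\<^sup>2"
    by (simp add: exp_double)
  finally show "(norm (1 + w))\<^sup>2 \<le> (exp (Re w))\<^sup>2" .
qed auto

section \<open>The second logarithmic derivative at the origin\<close>

text \<open>For \<open>f 0 = 1\<close> this is the second derivative of \<open>log f\<close> at \<open>0\<close>, written so that no branch of the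
logarithm has to be chosen. Being a logarithmic derivative, it turns the factors of a product
into summands.\<close>

definition log_deriv2_at_0 :: "(complex \<Rightarrow> complex) \<Rightarrow> complex" where
  "log_deriv2_at_0 f = (deriv ^^ 2) f 0 - (deriv f 0)\<^sup>2"

lemma log_deriv2_at_0_mult:
  assumes "f analytic_on {0}" "g analytic_on {0}" "f 0 = 1" "g 0 = 1"
  shows "log_deriv2_at_0 (\<lambda>z. f z * g z) = log_deriv2_at_0 f + log_deriv2_at_0 g"
  unfolding log_deriv2_at_0_def
    higher_deriv_mult_at[OF assms(1,2)] complex_derivative_mult_at[OF assms(1,2)]
  using assms(3,4) by (simp add: numeral_2_eq_2 power2_eq_square algebra_simps)

lemma log_deriv2_at_0_linear: "log_deriv2_at_0 (\<lambda>z. 1 - z / a) = - 1 / a\<^sup>2"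
proof -
  have "deriv (\<lambda>z. 1 - z / a) = (\<lambda>z. - 1 / a)"
    unfolding divide_inverse by (intro ext DERIV_imp_deriv) (auto intro!: derivative_eq_intros)
  thus ?thesis
    by (simp add: log_deriv2_at_0_def numeral_2_eq_2 power2_eq_square)
qed

lemma log_deriv2_at_0_exp:
  assumes hol: "g holomorphic_on ball 0 r" and r: "r > 0" and g0: "g 0 = 0"
    and f: "\<And>z. z \<in> ball 0 r \<Longrightarrow> f z = exp (g z)"
  shows "log_deriv2_at_0 f = (deriv ^^ 2) g 0"
proof -
  have dg: "(g has_field_derivative deriv g z) (at z)" if "z \<in> ball 0 r" for z
    using hol that holomorphic_derivI by blast
  have "(f has_field_derivative exp (g z) * deriv g z) (at z)" if z: "z \<in> ball 0 r" for z
  proof -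
    have "((\<lambda>z. exp (g z)) has_field_derivative exp (g z) * deriv g z) (at z)"
      using dg[OF z] by (auto intro!: derivative_eq_intros)
    thus ?thesis
      using f z by (rule_tac has_field_derivative_transform_within_open[of _ _ z "ball 0 r"]) auto
  qed
  hence df: "deriv f z = exp (g z) * deriv g z" if "z \<in> ball 0 r" for z
    using that by (auto intro: DERIV_imp_deriv)
  have "(deriv ^^ 2) f 0 = deriv (\<lambda>z. exp (g z) * deriv g z) 0"
    using df r by (simp add: numeral_2_eq_2)
      (intro deriv_cong_ev eventually_mono[OF eventually_nhds_in_open[of "ball 0 r" 0]], auto)
  also have "\<dots> = exp (g 0) * deriv g 0 * deriv g 0 + exp (g 0) * deriv (deriv g) 0"
  proof (rule DERIV_imp_deriv)
    have "(deriv g has_field_derivative deriv (deriv g) 0) (at 0)"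
      using holomorphic_deriv[OF hol] r by (auto intro: holomorphic_derivI[of _ "ball 0 r"])
    thus "((\<lambda>z. exp (g z) * deriv g z) has_field_derivative
        exp (g 0) * deriv g 0 * deriv g 0 + exp (g 0) * deriv (deriv g) 0) (at 0)"
      using dg[of 0] r by (auto intro!: derivative_eq_intros)
  qed
  finally show ?thesis
    using df[of 0] r g0 by (simp add: log_deriv2_at_0_def numeral_2_eq_2 power2_eq_square)
qed

section \<open>Splitting off finitely many zeros\<close>

text \<open>Near \<open>a\<close> the cofactor comes from the local factorization at a zero of finite order; off \<open>a\<close> it is
\<open>f z / (z - a) ^ n\<close>, and the two definitions glue to an entire function.\<close>

lemma split_off_zero:
  assumes hol: "f holomorphic_on UNIV" and nonzero: "f b \<noteq> 0" and a: "f a = 0"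
  obtains n h where "n > 0" "h holomorphic_on UNIV" "h a \<noteq> 0" "\<And>z. f z = (z - a) ^ n * h z"
proof -
  have "\<not> f constant_on UNIV"
    using a nonzero unfolding constant_on_def by (metis UNIV_I)
  then obtain g r n where n: "0 < n" and r: "0 < r" and g: "g holomorphic_on ball a r"
    and fg: "\<And>w. w \<in> ball a r \<Longrightarrow> f w = (w - a) ^ n * g w"
    and gnz: "\<And>w. w \<in> ball a r \<Longrightarrow> g w \<noteq> 0"
    using holomorphic_factor_zero_nonconstant[OF hol open_UNIV connected_UNIV UNIV_I a] by metis
  define h where "h z = (if z = a then g a else f z / (z - a) ^ n)" for z
  have hg: "h z = g z" if "z \<in> ball a r" for z
    using fg[OF that] by (auto simp: h_def)
  have "h holomorphic_on ball a r"
    by (rule holomorphic_transform[OF g]) (simp add: hg)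
  moreover have "(\<lambda>z. f z / (z - a) ^ n) holomorphic_on - {a}"
    by (auto intro!: holomorphic_intros holomorphic_on_subset[OF hol])
  hence "h holomorphic_on - {a}"
    by (rule holomorphic_transform) (auto simp: h_def)
  ultimately have "h holomorphic_on ball a r \<union> - {a}"
    by (intro holomorphic_on_Un) auto
  moreover have "ball a r \<union> - {a} = UNIV" using r by auto
  ultimately have "h holomorphic_on UNIV" by simp
  moreover have "f z = (z - a) ^ n * h z" for z
    using a n by (auto simp: h_def)
  ultimately show thesis
    using that[of n h] n gnz[of a] r by (auto simp: h_def)
qed

text \<open>A finite and explicit substitute for the Hadamard factorization: the zeros in one disc are split
off, repeated according to multiplicity, and the rest is only known to be zero free on that
disc. The factors are normalized to \<open>1\<close> at the origin so that values at \<open>0\<close> and second logarithmic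
derivatives combine without constants.\<close>

lemma factor_zeros_on_cball:
  assumes "f holomorphic_on UNIV" "f 0 = 1"
  obtains as F where "F holomorphic_on UNIV" "F 0 = 1"
    "\<And>z. f z = (\<Prod>a\<leftarrow>as. 1 - z / a) * F z"
    "\<And>a. a \<in> set as \<Longrightarrow> f a = 0 \<and> a \<noteq> 0 \<and> norm a \<le> R"
    "\<And>z. norm z \<le> R \<Longrightarrow> F z \<noteq> 0"
proof -
  have "\<exists>as F. F holomorphic_on UNIV \<and> F 0 = 1 \<and> (\<forall>z. f z = (\<Prod>a\<leftarrow>as. 1 - z / a) * F z) \<and>
      (\<forall>a\<in>set as. f a = 0 \<and> a \<noteq> 0 \<and> norm a \<le> R) \<and> (\<forall>z. norm z \<le> R \<longrightarrow> F z \<noteq> 0)"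
    if "finite S" "{z \<in> cball 0 R. f z = 0} = S" "f holomorphic_on UNIV" "f 0 = 1" for S f
    using that
  proof (induction S arbitrary: f rule: finite_induct)
    case empty
    thus ?case by (intro exI[of _ "[]"] exI[of _ f]) auto
  next
    case (insert a S)
    have "a \<in> {z \<in> cball 0 R. f z = 0}"
      unfolding insert.prems(1) by simp
    hence a: "f a = 0" "norm a \<le> R" "a \<noteq> 0"
      using insert.prems(3) by auto
    obtain n h where n: "n > 0" and h: "h holomorphic_on UNIV" "h a \<noteq> 0"
      and fh: "\<And>z. f z = (z - a) ^ n * h z"
      using split_off_zero[OF insert.prems(2) _ a(1)] insert.prems(3) by (metis zero_neq_one)
    \<comment> \<open>The constant renormalizes \<open>(z - a) ^ n\<close> to \<open>(1 - z / a) ^ n\<close>.\<close>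
    define k where "k z = (- a) ^ n * h z" for z
    have fk: "f z = (1 - z / a) ^ n * k z" for z
    proof -
      have "z - a = (1 - z / a) * (- a)" using a by (simp add: field_simps)
      thus ?thesis by (simp only: fh k_def power_mult_distrib mult.assoc)
    qed
    have "k holomorphic_on UNIV" unfolding k_def by (intro holomorphic_intros h)
    moreover have "k 0 = 1" using fk[of 0] insert.prems(3) by simp
    moreover have "k a \<noteq> 0" using h a by (simp add: k_def)
    hence "{z \<in> cball 0 R. k z = 0} = {z \<in> cball 0 R. f z = 0} - {a}"
      using a n by (auto simp: fk)
    hence "{z \<in> cball 0 R. k z = 0} = S"
      using insert.prems(1) insert.hyps(2) by simp
    ultimately obtain as F where F: "F holomorphic_on UNIV" "F 0 = 1"
        "\<And>z. k z = (\<Prod>a\<leftarrow>as. 1 - z / a) * F z"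
        "\<And>a. a \<in> set as \<Longrightarrow> k a = 0 \<and> a \<noteq> 0 \<and> norm a \<le> R"
        "\<And>z. norm z \<le> R \<Longrightarrow> F z \<noteq> 0"
      using insert.IH[of k] by blast
    show ?case
    proof (intro exI[of _ "replicate n a @ as"] exI[of _ F] conjI ballI allI impI)
      show "f z = (\<Prod>a\<leftarrow>replicate n a @ as. 1 - z / a) * F z" for z
        by (simp add: fk[of z] F(3) prod_list_replicate mult.assoc)
      show "f b = 0" "b \<noteq> 0" "norm b \<le> R" if "b \<in> set (replicate n a @ as)" for b
        using that a F(4)[of b] fk[of b] by (auto split: if_splits)
    qed (use F in auto)
  qed
  moreover have "\<not> f constant_on UNIV" if "\<exists>z. f z = 0"
    using that assms(2) unfolding constant_on_def by (metis UNIV_I zero_neq_one)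
  hence "finite {z \<in> cball 0 R. f z = 0}"
    using holomorphic_compact_finite_zeros[OF assms(1), of "cball 0 R"]
    by (cases "\<exists>z. f z = 0") auto
  ultimately have "\<exists>as F. F holomorphic_on UNIV \<and> F 0 = 1 \<and> (\<forall>z. f z = (\<Prod>a\<leftarrow>as. 1 - z / a) * F z) \<and>
      (\<forall>a\<in>set as. f a = 0 \<and> a \<noteq> 0 \<and> norm a \<le> R) \<and> (\<forall>z. norm z \<le> R \<longrightarrow> F z \<noteq> 0)"
    using assms by blast
  thus thesis using that by blast
qed

section \<open>Growth on the imaginary axis\<close>

lemma log_deriv2_at_0_linear_prod:
  assumes "\<And>a. a \<in> set as \<Longrightarrow> a \<noteq> 0" "F analytic_on {0}" "F 0 = 1"
  shows "log_deriv2_at_0 (\<lambda>z. (\<Prod>a\<leftarrow>as. 1 - z / a) * F z) =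
    log_deriv2_at_0 F - (\<Sum>a\<leftarrow>as. 1 / a\<^sup>2)"
  using assms(1)
proof (induction as)
  case (Cons a as)
  have an: "(\<lambda>z. (\<Prod>a\<leftarrow>bs. 1 - z / a)) analytic_on {0}" if "0 \<notin> set bs" for bs :: "complex list"
    using that by (induction bs) (auto intro!: analytic_intros)
  have "(\<Prod>a\<leftarrow>as. 1 - 0 / a) = (1 :: complex)" by (induction as) auto
  hence "log_deriv2_at_0 (\<lambda>z. (1 - z / a) * ((\<Prod>a\<leftarrow>as. 1 - z / a) * F z)) =
    log_deriv2_at_0 (\<lambda>z. 1 - z / a) + log_deriv2_at_0 (\<lambda>z. (\<Prod>a\<leftarrow>as. 1 - z / a) * F z)"
    using Cons.prems assms(2,3)
    by (intro log_deriv2_at_0_mult) (auto intro!: analytic_intros an)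
  thus ?case
    using Cons by (simp add: log_deriv2_at_0_linear mult.assoc)
qed simp

text \<open>Multiplying the values at \<open>it\<close> and \<open>-it\<close> removes the odd part: each zero contributes
\<open>(1 - it/a) (1 + it/a) = 1 + t\<^sup>2 / a\<^sup>2\<close>, and the sector condition passes from \<open>a\<^sup>2\<close> to its reciprocal.\<close>

lemma norm_linear_prod_imaginary_le:
  fixes t :: real
  assumes "\<And>a. a \<in> set as \<Longrightarrow> a \<noteq> 0 \<and> \<bar>Im (a\<^sup>2)\<bar> \<le> Re (a\<^sup>2)"
  shows "norm ((\<Prod>a\<leftarrow>as. 1 - \<i> * t / a) * (\<Prod>a\<leftarrow>as. 1 - - (\<i> * t) / a))
    \<le> exp (t\<^sup>2 * Re (\<Sum>a\<leftarrow>as. 1 / a\<^sup>2))"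
  using assms
proof (induction as)
  case (Cons a as)
  let ?w = "t\<^sup>2 * (1 / a\<^sup>2)"
  have "a \<noteq> 0" and sector: "\<bar>Im (a\<^sup>2)\<bar> \<le> Re (a\<^sup>2)" using Cons.prems by auto
  hence "(1 - \<i> * t / a) * (1 - - (\<i> * t) / a) = 1 + ?w"
    by (simp add: field_simps power2_eq_square)
  moreover have "\<bar>Im ?w\<bar> \<le> Re ?w"
  proof -
    define b where "b = a\<^sup>2"
    define N where "N = (Re b)\<^sup>2 + (Im b)\<^sup>2"
    have "Re ?w = t\<^sup>2 / N * Re b" "Im ?w = - (t\<^sup>2 / N * Im b)"
      unfolding b_def[symmetric] N_def by (simp_all add: Re_divide Im_divide)
    moreover have "t\<^sup>2 / N * \<bar>Im b\<bar> \<le> t\<^sup>2 / N * Re b"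
      using sector unfolding b_def[symmetric] by (intro mult_left_mono) (auto simp: N_def)
    hence "\<bar>- (t\<^sup>2 / N * Im b)\<bar> \<le> t\<^sup>2 / N * Re b"
      by (simp only: abs_minus_cancel abs_mult) (simp add: N_def)
    ultimately show ?thesis
      unfolding b_def[symmetric] by (simp only:)
  qed
  ultimately have "norm ((1 - \<i> * t / a) * (1 - - (\<i> * t) / a)) \<le> exp (Re ?w)"
    using norm_one_plus_le_exp_Re by metis
  moreover have "norm ((\<Prod>a\<leftarrow>as. 1 - \<i> * t / a) * (\<Prod>a\<leftarrow>as. 1 - - (\<i> * t) / a))
      \<le> exp (t\<^sup>2 * Re (\<Sum>a\<leftarrow>as. 1 / a\<^sup>2))"
    using Cons by auto
  ultimately have "norm ((1 - \<i> * t / a) * (1 - - (\<i> * t) / a)) *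
      norm ((\<Prod>a\<leftarrow>as. 1 - \<i> * t / a) * (\<Prod>a\<leftarrow>as. 1 - - (\<i> * t) / a))
      \<le> exp (Re ?w) * exp (t\<^sup>2 * Re (\<Sum>a\<leftarrow>as. 1 / a\<^sup>2))"
    by (intro mult_mono) auto
  also have "Re ?w = t\<^sup>2 * Re (1 / a\<^sup>2)"
    by (simp only: Re_complex_of_real Im_complex_of_real times_complex.sel mult_zero_left diff_0_right flip: of_real_power)
  also have "exp (t\<^sup>2 * Re (1 / a\<^sup>2)) * exp (t\<^sup>2 * Re (\<Sum>a\<leftarrow>as. 1 / a\<^sup>2)) =
      exp (t\<^sup>2 * Re (\<Sum>a\<leftarrow>a # as. 1 / a\<^sup>2))"
    by (simp add: exp_add distrib_left)
  finally show ?case by (simp add: norm_mult mult_ac)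
qed simp

text \<open>A zero-free function is \<open>exp g\<close>, and a one-sided bound \<open>K\<close> on \<open>Re g\<close> in a disc of radius \<open>R\<close> makes the
third derivative of \<open>g\<close> near \<open>0\<close> of order \<open>K / R\<^sup>3\<close>. Up to this error \<open>g\<close> is a quadratic polynomial, whose
linear term cancels in \<open>g (it) + g (- it)\<close>. In the application \<open>K\<close> grows like \<open>R\<^sup>2\<close>, which is why the
Taylor expansion has to go up to the second order and need not go further.\<close>

lemma norm_zero_free_imaginary_le:
  fixes t :: real
  assumes hol: "F holomorphic_on ball 0 R" and F0: "F 0 = 1"
    and nz: "\<And>z. norm z < R \<Longrightarrow> F z \<noteq> 0"
    and bound: "\<And>z. norm z < R \<Longrightarrow> norm (F z) < exp K"
    and t: "4 * \<bar>t\<bar> < R"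
  shows "norm (F (\<i> * t) * F (- (\<i> * t)))
    \<le> exp (- t\<^sup>2 * Re (log_deriv2_at_0 F) + 768 * K * \<bar>t\<bar> ^ 3 / R ^ 3)"
proof -
  have R: "R > 0" using t by auto
  obtain g0 where g0: "g0 holomorphic_on ball 0 R" "\<And>z. z \<in> ball 0 R \<Longrightarrow> F z = exp (g0 z)"
    using contractible_imp_holomorphic_log[OF hol convex_imp_contractible[OF convex_ball]] nz
    by (metis dist_0_norm mem_ball)
  define g where "g z = g0 z - g0 0" for z
  have g: "g holomorphic_on ball 0 R" "g 0 = 0"
    unfolding g_def by (auto intro!: holomorphic_intros g0)
  have Fg: "F z = exp (g z)" if "z \<in> ball 0 R" for z
    using g0(2)[of 0] g0(2)[OF that] F0 R by (simp add: g_def exp_diff)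
  have K: "K > 0" using bound[of 0] F0 R by simp
  have "Re (g z) < K" if "norm z < R" for z
    using bound[OF that] Fg[of z] that by simp
  hence BC: "norm (g z) \<le> 2 * K * norm z / (R - norm z)" if "norm z < R" for z
    using Borel_Caratheodory[OF g] that by blast
  have g_le: "norm (g z) \<le> 2 * K" if z: "norm z \<le> R / 2" for z
  proof -
    \<comment> \<open>At \<open>norm z = R / 2\<close> both sides agree.\<close>
    have "2 * K * norm z / (R - norm z) \<le> 2 * K"
      using z R K by (simp add: field_simps)
    thus ?thesis using BC[of z] z R by linarith
  qed
  have d3: "norm ((deriv ^^ 3) g x) \<le> 768 * K / R ^ 3" if x: "x \<in> cball 0 (R / 4)" for x
  proof -
    have sub: "cball x (R / 4) \<subseteq> cball 0 (R / 2)"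
      using x R by (auto simp: subset_iff) (smt (verit) dist_commute dist_triangle dist_0_norm)
    also have "\<dots> \<subseteq> ball 0 R" using R by auto
    finally have hol': "g holomorphic_on cball x (R / 4)"
      using g(1) holomorphic_on_subset by blast
    \<comment> \<open>Discs of radius \<open>R / 4\<close> around points of norm at most \<open>R / 4\<close> stay where \<open>norm (g z) \<le> 2 * K\<close>.\<close>
    have "norm ((deriv ^^ 3) g x) \<le> fact 3 * (2 * K) / (R / 4) ^ 3"
    proof (rule Cauchy_inequality)
      show "norm (g y) \<le> 2 * K" if "norm (x - y) = R / 4" for y
        using that sub by (intro g_le) (auto simp: subset_iff dist_norm)
    qed (use R in \<open>auto intro: holomorphic_on_subset[OF hol'] holomorphic_on_imp_continuous_on[OF hol']\<close>)
    also have "\<dots> = 768 * K / R ^ 3"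
      by (simp add: fact_numeral power_divide)
    finally show ?thesis .
  qed
  have taylor: "norm (g z - (deriv g 0 * z + (deriv ^^ 2) g 0 * z\<^sup>2 / 2)) \<le> 384 * K / R ^ 3 * \<bar>t\<bar> ^ 3"
    if z: "norm z = \<bar>t\<bar>" for z
  proof -
    have deriv: "((deriv ^^ i) g has_field_derivative (deriv ^^ Suc i) g x) (at x within cball 0 (R / 4))"
      if "x \<in> cball 0 (R / 4)" for i x
      by (rule has_field_derivative_at_within, rule has_field_derivative_higher_deriv[OF g(1) open_ball])
         (use that R in simp)
    have "norm ((deriv ^^ 0) g z - (\<Sum>i\<le>2. (deriv ^^ i) g 0 * (z - 0) ^ i / fact i))
        \<le> 768 * K / R ^ 3 * norm (z - 0) ^ Suc 2 / fact 2"
      by (rule complex_Taylor[of "cball 0 (R / 4)" 2 "\<lambda>i. (deriv ^^ i) g" "768 * K / R ^ 3" 0 z])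
         (use deriv d3 z t in \<open>simp_all del: funpow.simps\<close>)
    thus ?thesis using z g(2)
      by (simp add: numeral_2_eq_2 numeral_3_eq_3 fact_numeral field_simps)
  qed
  define z where "z = \<i> * complex_of_real t"
  have nz: "norm z = \<bar>t\<bar>" "norm (- z) = \<bar>t\<bar>" by (simp_all add: z_def norm_mult)
  let ?P = "\<lambda>z. deriv g 0 * z + (deriv ^^ 2) g 0 * z\<^sup>2 / 2"
  have "Re (g z + g (- z) - (?P z + ?P (- z))) \<le> norm ((g z - ?P z) + (g (- z) - ?P (- z)))"
    using complex_Re_le_cmod[of "(g z - ?P z) + (g (- z) - ?P (- z))"] by (simp add: algebra_simps)
  also have "\<dots> \<le> 384 * K / R ^ 3 * \<bar>t\<bar> ^ 3 + 384 * K / R ^ 3 * \<bar>t\<bar> ^ 3"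
    by (intro norm_triangle_mono taylor nz)
  also have "\<dots> = 768 * K * \<bar>t\<bar> ^ 3 / R ^ 3" by simp
  finally have "Re (g z + g (- z)) \<le> Re (?P z + ?P (- z)) + 768 * K * \<bar>t\<bar> ^ 3 / R ^ 3"
    by simp
  also have "?P z + ?P (- z) = - (t\<^sup>2 * log_deriv2_at_0 F)"
    using log_deriv2_at_0_exp[OF g(1) R g(2) Fg] by (simp add: z_def power_mult_distrib)
  also have "Re \<dots> = - t\<^sup>2 * Re (log_deriv2_at_0 F)"
    by (simp flip: of_real_power)
  finally have "Re (g z + g (- z)) \<le>
    - t\<^sup>2 * Re (log_deriv2_at_0 F) + 768 * K * \<bar>t\<bar> ^ 3 / R ^ 3" .
  moreover have "F z * F (- z) = exp (g z + g (- z))"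
    using Fg[of z] Fg[of "- z"] nz t by (simp add: exp_add)
  ultimately show ?thesis by (simp add: z_def)
qed

text \<open>After the zeros \<open>a\<close> in the disc of radius \<open>R\<close> have been split off, the growth bound on \<open>f\<close> has to be
passed to the cofactor. On the circle of radius \<open>2R\<close> every linear factor satisfies
\<open>|1 - z/a| \<ge> |z|/|a| - 1 \<ge> 1\<close>, so division by the factors does not increase the modulus there, and
the maximum principle carries the bound inwards. The zeros contribute the exponent
\<open>t\<^sup>2 Re (\<Sum> 1/a\<^sup>2)\<close>, and the cofactor contributes the rest of the second logarithmic derivative.\<close>

lemma norm_factored_imaginary_le:
  fixes A B R t :: real
  assumes hol: "f holomorphic_on UNIV" and f0: "f 0 = 1"
    and growth: "\<And>z. norm (f z) \<le> exp (A * (norm z)\<^sup>2 + B)"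
    and zeros: "\<And>z. f z = 0 \<Longrightarrow> \<bar>Im (z\<^sup>2)\<bar> \<le> Re (z\<^sup>2)"
    and t: "4 * \<bar>t\<bar> < R"
  shows "norm (f (\<i> * t) * f (- (\<i> * t)))
    \<le> exp (- t\<^sup>2 * Re (log_deriv2_at_0 f) + 768 * (A * (2 * R)\<^sup>2 + B + 1) * \<bar>t\<bar> ^ 3 / R ^ 3)"
proof -
  have R: "R > 0" using t by auto
  obtain as F where F: "F holomorphic_on UNIV" "F 0 = 1"
      and f_eq: "\<And>z. f z = (\<Prod>a\<leftarrow>as. 1 - z / a) * F z"
      and as: "\<And>a. a \<in> set as \<Longrightarrow> f a = 0 \<and> a \<noteq> 0 \<and> norm a \<le> R"
      and Fnz: "\<And>z. norm z \<le> R \<Longrightarrow> F z \<noteq> 0"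
    using factor_zeros_on_cball[OF hol f0, of R] by metis
  have cont: "continuous_on S F" and holS: "F holomorphic_on S" for S
    using F(1) holomorphic_on_subset holomorphic_on_imp_continuous_on by blast+
  have prod_ge: "1 \<le> norm (\<Prod>a\<leftarrow>as. 1 - z / a)" if z: "norm z = 2 * R" for z
    using as
  proof (induction as)
    case (Cons a as)
    have a: "a \<noteq> 0" "norm a \<le> R" using Cons.prems by auto
    hence "2 \<le> norm (z / a)" using z by (simp add: norm_divide field_simps)
    hence "1 \<le> norm (1 - z / a)"
      using norm_triangle_ineq2[of "z / a" 1] by (simp add: norm_minus_commute)
    moreover have "1 \<le> norm (\<Prod>a\<leftarrow>as. 1 - z / a)" using Cons by auto
    ultimately have "1 * 1 \<le> norm (1 - z / a) * norm (\<Prod>a\<leftarrow>as. 1 - z / a)"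
      by (intro mult_mono) auto
    thus ?case by (simp add: norm_mult)
  qed simp
  have F_sphere: "norm (F z) \<le> exp (A * (2 * R)\<^sup>2 + B)" if z: "norm z = 2 * R" for z
  proof -
    have "norm (F z) \<le> norm (\<Prod>a\<leftarrow>as. 1 - z / a) * norm (F z)"
      using mult_right_mono[OF prod_ge[OF z], of "norm (F z)"] by simp
    also have "\<dots> \<le> exp (A * (2 * R)\<^sup>2 + B)"
      using growth[of z] z by (simp add: f_eq norm_mult)
    finally show ?thesis .
  qed
  have "norm (F z) \<le> exp (A * (2 * R)\<^sup>2 + B)" if "norm z < R" for z
    by (rule maximum_modulus_frontier[of _ "cball 0 (2 * R)"])
       (use that R F_sphere cont holS in auto)
  \<comment> \<open>The summand \<open>1\<close> makes the bound strict, as the estimate of zero-free functions requires.\<close>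
  hence F_lt: "norm (F z) < exp (A * (2 * R)\<^sup>2 + B + 1)" if "norm z < R" for z
    by (rule le_less_trans) (use that in auto)
  have D: "log_deriv2_at_0 f = log_deriv2_at_0 F - (\<Sum>a\<leftarrow>as. 1 / a\<^sup>2)"
    unfolding f_eq[abs_def] using as F
    by (intro log_deriv2_at_0_linear_prod) (auto simp: analytic_on_open holS analytic_on_holomorphic)
  let ?e = "768 * (A * (2 * R)\<^sup>2 + B + 1) * \<bar>t\<bar> ^ 3 / R ^ 3"
  have "norm (f (\<i> * t) * f (- (\<i> * t))) =
      norm ((\<Prod>a\<leftarrow>as. 1 - \<i> * t / a) * (\<Prod>a\<leftarrow>as. 1 - - (\<i> * t) / a)) * norm (F (\<i> * t) * F (- (\<i> * t)))"
    by (simp add: f_eq norm_mult mult_ac)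
  also have "\<dots> \<le> exp (t\<^sup>2 * Re (\<Sum>a\<leftarrow>as. 1 / a\<^sup>2)) * exp (- t\<^sup>2 * Re (log_deriv2_at_0 F) + ?e)"
    using as zeros Fnz F_lt t F(2)
    by (intro mult_mono norm_linear_prod_imaginary_le norm_zero_free_imaginary_le holS) auto
  also have "\<dots> = exp (- t\<^sup>2 * Re (log_deriv2_at_0 f) + ?e)"
    by (simp add: D algebra_simps flip: exp_add)
  finally show ?thesis .
qed

text \<open>Under growth of order at most two and finite type the error term of the previous lemma is
\<open>O (1 / R)\<close>, while the main term does not depend on \<open>R\<close>: for each \<open>R\<close> the zeros and the cofactor
together account for the whole second logarithmic derivative.\<close>

lemma norm_entire_imaginary_le:
  fixes A B t :: real
  assumes hol: "f holomorphic_on UNIV" and f0: "f 0 = 1"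
    and growth: "\<And>z. norm (f z) \<le> exp (A * (norm z)\<^sup>2 + B)"
    and zeros: "\<And>z. f z = 0 \<Longrightarrow> \<bar>Im (z\<^sup>2)\<bar> \<le> Re (z\<^sup>2)"
  shows "norm (f (\<i> * t) * f (- (\<i> * t))) \<le> exp (- t\<^sup>2 * Re (log_deriv2_at_0 f))"
proof (rule tendsto_lowerbound)
  let ?e = "\<lambda>R. 768 * (A * (2 * R)\<^sup>2 + B + 1) * \<bar>t\<bar> ^ 3 / R ^ 3"
  have "(?e \<longlongrightarrow> 0) at_top" by real_asymp
  from tendsto_exp[OF tendsto_add[OF tendsto_const this]]
  show "((\<lambda>R. exp (- t\<^sup>2 * Re (log_deriv2_at_0 f) + ?e R)) \<longlongrightarrow> exp (- t\<^sup>2 * Re (log_deriv2_at_0 f))) at_top"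
    unfolding add_0_right .
  show "\<forall>\<^sub>F R in at_top. norm (f (\<i> * t) * f (- (\<i> * t))) \<le> exp (- t\<^sup>2 * Re (log_deriv2_at_0 f) + ?e R)"
    using eventually_gt_at_top[of "4 * \<bar>t\<bar>"]
    by eventually_elim (rule norm_factored_imaginary_le[OF assms])
qed simp

section \<open>The characteristic function of a subgaussian variable\<close>

lemma linear_le_quadratic:
  fixes c s x :: real
  assumes "c > 0"
  shows "s * x \<le> c * x\<^sup>2 + s\<^sup>2 / (4 * c)"
proof -
  \<comment> \<open>Completing the square.\<close>
  have "0 \<le> (2 * c * x - s)\<^sup>2 / (4 * c)" using assms by simp
  also have "\<dots> = c * x\<^sup>2 + s\<^sup>2 / (4 * c) - s * x"
    using assms by (simp add: power2_eq_square field_simps)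
  finally show ?thesis by simp
qed

lemma subgaussian_integrable_exp_abs:
  assumes "X \<in> borel_measurable M" "subgaussian M X"
  shows "integrable M (\<lambda>\<omega>. exp (s * \<bar>X \<omega>\<bar>))"
proof -
  obtain c where c: "c > 0" "integrable M (\<lambda>\<omega>. exp (c * (X \<omega>)\<^sup>2))"
    using assms(2) by (auto simp: subgaussian_def)
  show ?thesis
  proof (rule Bochner_Integration.integrable_bound)
    show "integrable M (\<lambda>\<omega>. exp (s\<^sup>2 / (4 * c)) * exp (c * (X \<omega>)\<^sup>2))"
      using c(2) by simp
    show "(\<lambda>\<omega>. exp (s * \<bar>X \<omega>\<bar>)) \<in> borel_measurable M"
      using assms(1) by measurable
    show "AE \<omega> in M. norm (exp (s * \<bar>X \<omega>\<bar>)) \<le> norm (exp (s\<^sup>2 / (4 * c)) * exp (c * (X \<omega>)\<^sup>2))"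
      using linear_le_quadratic[OF c(1), of s "\<bar>X _\<bar>"]
      by (auto simp flip: exp_add simp: add.commute)
  qed
qed

lemma subgaussian_integrable_exp:
  assumes "X \<in> borel_measurable M" "subgaussian M X"
  shows "integrable M (\<lambda>\<omega>. exp (t * X \<omega>))"
proof (rule Bochner_Integration.integrable_bound[OF subgaussian_integrable_exp_abs[OF assms, of "\<bar>t\<bar>"]])
  show "(\<lambda>\<omega>. exp (t * X \<omega>)) \<in> borel_measurable M"
    using assms(1) by measurable
  show "AE \<omega> in M. norm (exp (t * X \<omega>)) \<le> norm (exp (\<bar>t\<bar> * \<bar>X \<omega>\<bar>))"
    by (simp flip: abs_mult)
qed

text \<open>By completing the square, \<open>|z| |X| \<le> c X\<^sup>2 + |z|\<^sup>2 / (4c)\<close>, and \<open>exp (c X\<^sup>2)\<close> is integrable.\<close>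

lemma complex_char_growth:
  assumes "prob_space M" "X \<in> borel_measurable M" "subgaussian M X"
  obtains A B where "\<And>z. norm (complex_char M X z) \<le> exp (A * (norm z)\<^sup>2 + B)"
proof -
  interpret prob_space M by fact
  obtain c where c: "c > 0" "integrable M (\<lambda>\<omega>. exp (c * (X \<omega>)\<^sup>2))"
    using assms(3) by (auto simp: subgaussian_def)
  let ?K = "expectation (\<lambda>\<omega>. exp (c * (X \<omega>)\<^sup>2))"
  have "1 \<le> ?K"
    using c integral_mono[of M "\<lambda>_. 1" "\<lambda>\<omega>. exp (c * (X \<omega>)\<^sup>2)"] by (simp add: prob_space)
  have "norm (complex_char M X z) \<le> exp (1 / (4 * c) * (norm z)\<^sup>2 + ln ?K)" for z
  proof -
    have "norm (exp (\<i> * z * of_real (X \<omega>))) \<le> exp ((norm z)\<^sup>2 / (4 * c)) * exp (c * (X \<omega>)\<^sup>2)" for \<omega>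
    proof -
      have "norm (exp (\<i> * z * of_real (X \<omega>))) \<le> exp (norm (\<i> * z * of_real (X \<omega>)))"
        by (rule norm_exp)
      also have "\<dots> \<le> exp (c * \<bar>X \<omega>\<bar>\<^sup>2 + (norm z)\<^sup>2 / (4 * c))"
        using linear_le_quadratic[OF c(1), of "norm z" "\<bar>X \<omega>\<bar>"] by (simp add: norm_mult)
      finally show ?thesis by (simp add: exp_add mult.commute)
    qed
    hence "norm (complex_char M X z) \<le> expectation (\<lambda>\<omega>. exp ((norm z)\<^sup>2 / (4 * c)) * exp (c * (X \<omega>)\<^sup>2))"
      unfolding complex_char_def using c(2)
      by (intro order.trans[OF integral_norm_bound] integral_mono') auto
    also have "\<dots> = exp (1 / (4 * c) * (norm z)\<^sup>2 + ln ?K)"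
      using \<open>1 \<le> ?K\<close> by (simp add: exp_add)
    finally show ?thesis .
  qed
  thus thesis using that by blast
qed

lemma sum_le_exp:
  fixes x :: real
  assumes "x \<ge> 0" "finite I"
  shows "(\<Sum>n\<in>I. x ^ n /\<^sub>R fact n) \<le> exp x"
  unfolding exp_def using assms by (intro sum_le_suminf summable_exp_generic) auto

text \<open>Expectation and exponential series may be exchanged because the partial sums of the moduli are
dominated by \<open>exp (|z| |X|)\<close>. The power series yields at once that the characteristic function is
entire and that its derivatives at \<open>0\<close> are the moments up to powers of \<open>\<i>\<close>.\<close>

lemma complex_char_sums:
  assumes X[measurable]: "X \<in> borel_measurable M" and "subgaussian M X"
  shows "integrable M (\<lambda>\<omega>. X \<omega> ^ n)"
    and "(\<lambda>n. \<i> ^ n * (\<integral>\<omega>. X \<omega> ^ n \<partial>M) / fact n * z ^ n) sums complex_char M X z"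
proof -
  have int: "integrable M (\<lambda>\<omega>. X \<omega> ^ n)" for n
  proof (rule Bochner_Integration.integrable_bound)
    show "integrable M (\<lambda>\<omega>. fact n * exp (1 * \<bar>X \<omega>\<bar>))"
      using subgaussian_integrable_exp_abs[OF assms, of 1] by simp
    have "\<bar>x\<bar> ^ n \<le> fact n * exp \<bar>x\<bar>" for x :: real
      using sum_le_exp[of "\<bar>x\<bar>" "{n}"] by (simp add: field_simps)
    thus "AE \<omega> in M. norm (X \<omega> ^ n) \<le> norm (fact n * exp (1 * \<bar>X \<omega>\<bar>))"
      by (simp add: power_abs abs_mult)
  qed simp
  thus "integrable M (\<lambda>\<omega>. X \<omega> ^ n)" .
  define f where "f n \<omega> = (\<i> * z * X \<omega>) ^ n /\<^sub>R fact n" for n \<omega>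
  have f: "f n \<omega> = \<i> ^ n * z ^ n / fact n * of_real (X \<omega> ^ n)" for n \<omega>
    by (simp add: f_def power_mult_distrib scaleR_conv_of_real field_simps)
  have int_f: "integrable M (f n)" for n
    unfolding f by (intro integrable_mult_right integrable_of_real int)
  have norm_f: "norm (f n \<omega>) = (norm z * \<bar>X \<omega>\<bar>) ^ n /\<^sub>R fact n" for n \<omega>
    by (simp add: f_def norm_mult norm_power)
  have "(\<lambda>n. integral\<^sup>L M (f n)) sums (\<integral>\<omega>. (\<Sum>n. f n \<omega>) \<partial>M)"
  proof (rule sums_integral[OF int_f])
    show "AE \<omega> in M. summable (\<lambda>n. norm (f n \<omega>))"
      unfolding norm_f using exp_converges[THEN sums_summable] by blast
    show "summable (\<lambda>n. \<integral>\<omega>. norm (f n \<omega>) \<partial>M)"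
    proof (rule summableI_nonneg_bounded)
      fix N
      have "(\<Sum>n<N. \<integral>\<omega>. norm (f n \<omega>) \<partial>M) = (\<integral>\<omega>. (\<Sum>n<N. norm (f n \<omega>)) \<partial>M)"
        using int_f by (intro Bochner_Integration.integral_sum[symmetric] integrable_norm)
      also have "\<dots> \<le> (\<integral>\<omega>. exp (norm z * \<bar>X \<omega>\<bar>) \<partial>M)"
      proof (rule integral_mono)
        show "(\<Sum>n<N. norm (f n \<omega>)) \<le> exp (norm z * \<bar>X \<omega>\<bar>)" for \<omega>
          unfolding norm_f by (intro sum_le_exp) auto
      qed (use int_f subgaussian_integrable_exp_abs[OF assms] in auto)
      finally show "(\<Sum>n<N. \<integral>\<omega>. norm (f n \<omega>) \<partial>M) \<le> (\<integral>\<omega>. exp (norm z * \<bar>X \<omega>\<bar>) \<partial>M)" .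
    qed simp
  qed
  also have "(\<integral>\<omega>. (\<Sum>n. f n \<omega>) \<partial>M) = complex_char M X z"
    unfolding complex_char_def f_def exp_def ..
  also have "(\<lambda>n. integral\<^sup>L M (f n)) = (\<lambda>n. \<i> ^ n * (\<integral>\<omega>. X \<omega> ^ n \<partial>M) / fact n * z ^ n)"
    unfolding f by (simp add: integral_of_real[symmetric] mult_ac del: of_real_power)
  finally show "(\<lambda>n. \<i> ^ n * (\<integral>\<omega>. X \<omega> ^ n \<partial>M) / fact n * z ^ n) sums complex_char M X z" .
qed

lemma complex_char_entire:
  assumes "X \<in> borel_measurable M" "subgaussian M X"
  shows "complex_char M X holomorphic_on UNIV"
proof -
  have "complex_char M X holomorphic_on ball 0 r" for r
    using complex_char_sums(2)[OF assms]
    by (intro power_series_holomorphic[where a = "\<lambda>n. \<i> ^ n * (\<integral>\<omega>. X \<omega> ^ n \<partial>M) / fact n"]) simp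
  hence "complex_char M X holomorphic_on (\<Union>r\<in>UNIV. ball 0 r)"
    by (intro holomorphic_on_UN_open) auto
  moreover have "(\<Union>r\<in>UNIV. ball (0 :: complex) r) = UNIV"
    by (auto intro: gt_ex)
  ultimately show ?thesis by simp
qed

lemma complex_char_0:
  assumes "prob_space M"
  shows "complex_char M X 0 = 1"
  using assms by (simp add: complex_char_def prob_space.prob_space)

lemma log_deriv2_at_0_complex_char:
  assumes "prob_space M" "X \<in> borel_measurable M" "subgaussian M X"
  shows "log_deriv2_at_0 (complex_char M X) = - prob_space.variance M X"
proof -
  interpret prob_space M by fact
  have "complex_char M X has_fps_expansion Abs_fps (\<lambda>n. \<i> ^ n * (\<integral>\<omega>. X \<omega> ^ n \<partial>M) / fact n)"
    by (rule has_fps_expansionI) (use complex_char_sums(2)[OF assms(2,3)] in simp)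
  from fps_nth_fps_expansion[OF this]
  have deriv: "(deriv ^^ n) (complex_char M X) 0 = \<i> ^ n * (\<integral>\<omega>. X \<omega> ^ n \<partial>M)" for n
    by (simp add: field_simps)
  have "variance X = expectation (\<lambda>\<omega>. (X \<omega>)\<^sup>2) - (expectation X)\<^sup>2"
    using complex_char_sums(1)[OF assms(2,3), of 1] complex_char_sums(1)[OF assms(2,3), of 2]
    by (intro variance_eq) auto
  thus ?thesis
    using deriv[of 1] deriv[of 2] by (simp add: log_deriv2_at_0_def power_mult_distrib)
qed

lemma complex_char_minus:
  assumes "X \<in> borel_measurable M" "symmetric_distribution M X"
  shows "complex_char M X (- z) = complex_char M X z"
proof -
  have [measurable]: "X \<in> borel_measurable M" by fact
  have distr: "(\<integral>x. exp (\<i> * z * of_real x) \<partial>distr M borel Y) = (\<integral>\<omega>. exp (\<i> * z * of_real (Y \<omega>)) \<partial>M)"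
    if "Y \<in> borel_measurable M" for Y
    using that
    by (intro integral_distr borel_measurable_continuous_onI continuous_intros)
  have "complex_char M X (- z) = (\<integral>x. exp (\<i> * z * of_real x) \<partial>distr M borel (\<lambda>\<omega>. - X \<omega>))"
    by (subst distr) (simp_all add: complex_char_def)
  also have "\<dots> = complex_char M X z"
    using assms(2) by (simp add: symmetric_distribution_def distr complex_char_def)
  finally show ?thesis .
qed

lemma complex_char_imaginary:
  "complex_char M X (- (\<i> * of_real t)) = of_real (\<integral>\<omega>. exp (t * X \<omega>) \<partial>M)"
proof -
  have "exp (\<i> * - (\<i> * of_real t) * of_real (X \<omega>)) = (of_real (exp (t * X \<omega>)) :: complex)" for \<omega>
    by (simp flip: exp_of_real mult.assoc)
  thus ?thesis by (simp add: complex_char_def)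
qed

section \<open>Strict subgaussianity\<close>

lemma abs_Im_square_le_Re_square:
  assumes "\<bar>Arg z\<bar> \<le> pi / 8"
  shows "\<bar>Im (z\<^sup>2)\<bar> \<le> Re (z\<^sup>2)"
proof (cases "z = 0")
  case False
  define \<theta> where "\<theta> = 2 * Arg z"
  have "z = rcis (norm z) (Arg z)" by (simp add: rcis_cmod_Arg)
  hence "z\<^sup>2 = rcis ((norm z)\<^sup>2) \<theta>"
    by (metis DeMoivre2 \<theta>_def of_nat_numeral)
  hence z2: "Re (z\<^sup>2) = (norm z)\<^sup>2 * cos \<theta>" "Im (z\<^sup>2) = (norm z)\<^sup>2 * sin \<theta>"
    by simp_all
  have \<theta>: "\<bar>\<theta>\<bar> \<le> pi / 4" using assms by (simp add: \<theta>_def)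
  have "\<bar>sin \<theta>\<bar> = sin \<bar>\<theta>\<bar>"
    using \<theta> sin_ge_zero[of "\<bar>\<theta>\<bar>"] by (auto simp: abs_if)
  also have "\<dots> \<le> sin (pi / 4)"
    using \<theta> by (intro sin_monotone_2pi_le) auto
  also have "\<dots> = cos (pi / 4)" by (simp add: sin_45 cos_45)
  also have "\<dots> \<le> cos \<bar>\<theta>\<bar>"
    using \<theta> by (intro cos_monotone_0_pi_le) auto
  also have "\<dots> = cos \<theta>" by simp
  finally show ?thesis
    unfolding z2 by (simp add: abs_mult mult_left_mono)
qed simp

theorem theorem1p3:
  fixes M :: "'a measure" and X :: "'a \<Rightarrow> real"
  assumes "prob_space M"
    and "X \<in> borel_measurable M"
    and "subgaussian M X"
    and "symmetric_distribution M X"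
    and "\<And>z::complex. complex_char M X z = 0 \<Longrightarrow> Re z \<ge> 0 \<Longrightarrow> \<bar>Arg z\<bar> \<le> pi / 8"
  shows "strictly_subgaussian M X"
proof -
  interpret prob_space M by fact
  let ?f = "complex_char M X" and ?V = "variance X"
  obtain A B where growth: "\<And>z. norm (?f z) \<le> exp (A * (norm z)\<^sup>2 + B)"
    using complex_char_growth[OF assms(1-3)] by blast
  note even = complex_char_minus[OF assms(2,4)]
  have zeros: "\<bar>Im (z\<^sup>2)\<bar> \<le> Re (z\<^sup>2)" if z: "?f z = 0" for z
  proof (cases "Re z \<ge> 0")
    case True
    thus ?thesis using z assms(5) abs_Im_square_le_Re_square by blast
  next
    case False
    hence "\<bar>Arg (- z)\<bar> \<le> pi / 8" using z even by (intro assms(5)) auto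
    thus ?thesis using abs_Im_square_le_Re_square[of "- z"] by simp
  qed
  have "expectation (\<lambda>\<omega>. exp (t * X \<omega>)) \<le> exp (?V * t\<^sup>2 / 2)" for t
  proof (rule power2_le_imp_le)
    \<comment> \<open>By symmetry the moment generating function takes the same value at \<open>t\<close> and \<open>- t\<close>, so its square is the product over the pair \<open>it\<close>, \<open>- it\<close>.\<close>
    have "(expectation (\<lambda>\<omega>. exp (t * X \<omega>)))\<^sup>2 = norm (?f (\<i> * t) * ?f (- (\<i> * t)))"
      unfolding even[of "\<i> * t", symmetric] complex_char_imaginary
      by (simp add: norm_mult power2_eq_square flip: of_real_mult)
    also have "\<dots> \<le> exp (- t\<^sup>2 * Re (log_deriv2_at_0 ?f))"
      using complex_char_entire[OF assms(2,3)] complex_char_0[OF assms(1)] growth zeros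
      by (rule norm_entire_imaginary_le)
    also have "\<dots> = (exp (?V * t\<^sup>2 / 2))\<^sup>2"
      by (simp add: log_deriv2_at_0_complex_char[OF assms(1-3)] mult.commute flip: exp_double)
    finally show "(expectation (\<lambda>\<omega>. exp (t * X \<omega>)))\<^sup>2 \<le> (exp (?V * t\<^sup>2 / 2))\<^sup>2" .
  qed simp
  thus ?thesis
    using subgaussian_integrable_exp[OF assms(2,3)] by (simp add: strictly_subgaussian_def)
qed

end
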